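(* Let $f(x) = 1-\frac{1}{4x}$ for $x\in[\frac12,1]$. Let $x_0\in[\frac12,1]$ and define a sequence $x_0,x_1,x_2,\dots$ by the iteration $x_{i+1}=f(x_i)$, $i=0,1,2,\dots$. Then $\lim_{n\to\infty}x_n = \frac12$. *)

theory Defs
  imports Complex_Main
begin

end

theory Submission
  imports Defs
begin

text \<open>
  The point \<open>1/2\<close> is a fixed point of \<open>f\<close> with derivative \<open>1\<close>, so no contraction argument
  applies. Writing \<open>d = t - 1/2\<close> for the distance to it, however, the iteration becomes the
  Moebius map \<open>d \<mapsto> d / (1 + 2 * d)\<close>, which is the translation by \<open>2\<close> in the coordinate \<open>1/d\<close>.
  As \<open>1/d\<close> is at least \<open>2\<close> at the start, it is at least \<open>2 * n + 2\<close> after \<open>n\<close> steps. This bound,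
  in the form \<open>(2 * n + 2) * d \<le> 1\<close> that also covers \<open>d = 0\<close>, is carried through an
  induction, and the squeeze theorem finishes the proof.
\<close>

lemma iterate_minus_half:
  fixes t :: real
  assumes "t \<ge> 1/2"
  shows "1 - 1 / (4 * t) - 1/2 = (t - 1/2) / (1 + 2 * (t - 1/2))"
  using assms by (simp add: field_simps)

lemma moebius_step_bound:
  fixes d c :: real
  assumes "d \<ge> 0" and "c * d \<le> 1"
  shows "(c + 2) * (d / (1 + 2 * d)) \<le> 1"
  using assms by (simp add: divide_simps algebra_simps)

theorem lemma2p2:
  fixes f :: "real \<Rightarrow> real" and x :: "nat \<Rightarrow> real"
  assumes f_def: "\<And>t. t \<in> {1/2..1} \<Longrightarrow> f t = 1 - 1 / (4 * t)"
    and x_0: "x 0 \<in> {1/2..1}"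
    and x_Suc: "\<And>i. x (Suc i) = f (x i)"
  shows "x \<longlonglongrightarrow> 1/2"
proof -
  have bounds: "x n \<ge> 1/2 \<and> (2 * real n + 2) * (x n - 1/2) \<le> 1" for n
  proof (induction n)
    case 0
    show ?case using x_0 by simp
  next
    case (Suc n)
    define d where "d = x n - 1/2"
    have d: "d \<ge> 0" "(2 * real n + 2) * d \<le> 1"
      using Suc by (simp_all add: d_def)
    \<comment> \<open>The formula for \<open>f\<close> holds only on the interval, so an upper bound \<open>1\<close> on the orbit is needed as well.\<close>
    have "2 * d \<le> (2 * real n + 2) * d"
      using d(1) by (intro mult_right_mono) auto
    then have "x n \<in> {1/2..1}"
      using d by (simp add: d_def)
    then have step: "x (Suc n) - 1/2 = d / (1 + 2 * d)"
      using f_def x_Suc iterate_minus_half[of "x n"] by (simp add: d_def)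
    have "d / (1 + 2 * d) \<ge> 0"
      using d(1) by simp
    moreover have "(2 * real (Suc n) + 2) * (d / (1 + 2 * d)) \<le> 1"
      using moebius_step_bound[OF d] by (simp add: add_ac)
    ultimately show ?case
      using step by simp
  qed
  have "x n \<le> 1/2 + 1/2 * inverse (real (Suc n))" for n
    using bounds[of n] by (simp add: field_simps)
  moreover have "(\<lambda>n. 1/2 + 1/2 * inverse (real (Suc n))) \<longlonglongrightarrow> 1/2 + 1/2 * 0"
    by (intro tendsto_intros LIMSEQ_inverse_real_of_nat)
  ultimately show ?thesis
    using bounds by (intro tendsto_sandwich[of "\<lambda>_. 1/2" x sequentially]) auto
qed

end
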